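(* Let $G$ and $H$ be finite simple graphs with subsets $B_G\subseteq V(G)$ and $B_H\subseteq V(H)$. If $$\zeta_G(B_G)<\zeta_H(B_H),$$ then there is no surjective graph homomorphism $f:G\to H$ with $f(B_G)=B_H$.
   Context: A graph homomorphism $f:G\to H$ is a map $f:V(G)\to V(H)$ such that $uv\in E(G)$ implies $f(u)f(v)\in E(H)$; it is surjective if it maps onto all of $V(H)$. For a finite simple graph $G$ and a subset $B\subseteq V(G)$, the $B$-restricted clique polynomial is $C_B(G;x)=\sum_{i=0}^{\omega(G[B])} c_i(B)x^i$, where $c_i(B)$ is the number of subsets $K\subseteq B$ with $|K|=i$ that are cliques in $G$; the empty set counts as a clique, so $c_0(B)=1$. Let $Z_B(G)=\{x<0 : C_B(G;x)=0\}$ (real $x$). If $Z_B(G)\neq\emptyset$, define $\zeta_G(B)=\max Z_B(G)$, the largest negative root of $C_B(G;x)$; if $Z_B(G)=\emptyset$, set $\zeta_G(B)=-\infty$. *)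

theory Defs
  imports
    "Graph_Theory.Digraph_Component"
    "HOL-Computational_Algebra.Polynomial"
    "HOL-Library.Extended_Real"
begin

text \<open>
  Finite simple graphs are the locale \<open>graph\<close> of \<open>Graph_Theory\<close>: finite, loop-free, symmetric
  digraphs without parallel arcs. An undirected edge \<open>uv\<close> is a pair of opposite arcs, so
  \<open>uv \<in> E(G)\<close> reads \<open>u \<rightarrow>\<^bsub>G\<^esub> v\<close>.
\<close>

definition graph_hom :: "('a, 'b) pre_digraph \<Rightarrow> ('c, 'd) pre_digraph \<Rightarrow> ('a \<Rightarrow> 'c) \<Rightarrow> bool" where
  "graph_hom G H f \<longleftrightarrow>
     (\<forall>v \<in> verts G. f v \<in> verts H) \<and> (\<forall>u v. u \<rightarrow>\<^bsub>G\<^esub> v \<longrightarrow> f u \<rightarrow>\<^bsub>H\<^esub> f v)"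

definition surj_graph_hom :: "('a, 'b) pre_digraph \<Rightarrow> ('c, 'd) pre_digraph \<Rightarrow> ('a \<Rightarrow> 'c) \<Rightarrow> bool" where
  "surj_graph_hom G H f \<longleftrightarrow> graph_hom G H f \<and> f ` verts G = verts H"

definition is_clique :: "('a, 'b) pre_digraph \<Rightarrow> 'a set \<Rightarrow> bool" where
  "is_clique G K \<longleftrightarrow> K \<subseteq> verts G \<and> (\<forall>u \<in> K. \<forall>v \<in> K. u \<noteq> v \<longrightarrow> u \<rightarrow>\<^bsub>G\<^esub> v)"

definition clique_number :: "('a, 'b) pre_digraph \<Rightarrow> nat" where
  "clique_number G = Max (card ` {K. is_clique G K})"

definition clique_count :: "('a, 'b) pre_digraph \<Rightarrow> 'a set \<Rightarrow> nat \<Rightarrow> nat" where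
  "clique_count G B i = card {K. K \<subseteq> B \<and> card K = i \<and> is_clique G K}"

definition clique_poly :: "('a, 'b) pre_digraph \<Rightarrow> 'a set \<Rightarrow> real poly" where
  "clique_poly G B = (\<Sum>i = 0..clique_number (G \<restriction> B). monom (of_nat (clique_count G B i)) i)"

definition neg_roots :: "('a, 'b) pre_digraph \<Rightarrow> 'a set \<Rightarrow> real set" where
  "neg_roots G B = {x. x < 0 \<and> poly (clique_poly G B) x = 0}"

definition zeta :: "('a, 'b) pre_digraph \<Rightarrow> 'a set \<Rightarrow> ereal" where
  "zeta G B = (if neg_roots G B = {} then - \<infinity> else ereal (Max (neg_roots G B)))"

lemma clique_count_0:
  assumes "finite B"
  shows "clique_count G B 0 = 1"
proof -
  have "{K. K \<subseteq> B \<and> card K = 0 \<and> is_clique G K} = {{}}"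
    using assms by (auto simp: is_clique_def dest: finite_subset)
  then show ?thesis by (simp add: clique_count_def)
qed

lemma clique_poly_nonzero:
  assumes "finite B"
  shows "clique_poly G B \<noteq> 0"
proof -
  have "coeff (clique_poly G B) 0 = 1"
    using assms by (simp add: clique_poly_def coeff_sum clique_count_0 sum.delta)
  then show ?thesis by auto
qed

text \<open>Hence the maximum in \<^const>\<open>zeta\<close> is that of a finite set.\<close>

lemma finite_neg_roots:
  assumes "finite B"
  shows "finite (neg_roots G B)"
  using poly_roots_finite[OF clique_poly_nonzero[OF assms]]
  by (rule finite_subset[rotated]) (auto simp: neg_roots_def)

end

theory Submission
  imports Defs
begin

text \<open>
  For a symmetric relation \<open>R\<close> and a finite set \<open>S\<close> let \<open>D\<^sub>S(x) = C\<^sub>S(-x)\<close>, the sum of \<open>(-x)\<^bsup>|K|\<^esup>\<close> over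
  all cliques \<open>K \<subseteq> S\<close>. It satisfies \<open>D\<^sub>S = D\<^bsub>S - v\<^esub> - x D\<^bsub>S \<inter> N(v)\<^esub>\<close>. Below the least positive root of
  \<open>D\<^sub>B\<close> all \<open>D\<^sub>S\<close> with \<open>S \<subseteq> B\<close> are positive, and by induction on \<open>S\<close> the ratios
  \<open>D\<^sub>S / D\<^sub>T\<close> (\<open>T \<subseteq> S\<close>) grow when edges are added, as in Shearer's version of the local lemma.
  A homomorphism that maps \<open>B\<^sub>G\<close> onto \<open>B\<^sub>H\<close> has a section \<open>B\<^sub>H \<rightarrow> B\<^sub>G\<close>, which makes the graph
  induced on \<open>B\<^sub>H\<close> arise from an induced subgraph of \<open>G[B\<^sub>G]\<close> by adding edges. So the least positive root
  for \<open>H\<close> is at least the one for \<open>G\<close>.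
\<close>

section \<open>Alternating clique sums and the deletion recurrence\<close>

text \<open>The parameter is a bare relation rather than a graph, so that adjacency pulled back
  along a section can be used without building a new graph.\<close>

definition clique_sum :: "('a \<Rightarrow> 'a \<Rightarrow> bool) \<Rightarrow> 'a set \<Rightarrow> real \<Rightarrow> real" where
  "clique_sum R S x = (\<Sum>K | K \<subseteq> S \<and> pairwise R K. (- x) ^ card K)"

lemma clique_sum_empty [simp]: "clique_sum R {} x = 1"
proof -
  have "{K. K \<subseteq> {} \<and> pairwise R K} = {{}}"
    by auto
  then show ?thesis
    by (simp add: clique_sum_def)
qed

lemma clique_sum_0:
  assumes "finite S"
  shows "clique_sum R S 0 = 1"
proof -
  have "clique_sum R S 0 = (\<Sum>K | K \<subseteq> S \<and> pairwise R K. if K = {} then 1 else 0)"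
    unfolding clique_sum_def
  proof (rule sum.cong)
    fix K assume "K \<in> {K. K \<subseteq> S \<and> pairwise R K}"
    then have "finite K"
      using assms by (auto dest: finite_subset)
    then show "(- 0) ^ card K = (if K = {} then 1 else (0::real))"
      by (auto simp: power_0_left)
  qed simp
  also have "\<dots> = 1"
    using assms by (simp add: sum.delta)
  finally show ?thesis .
qed

lemma continuous_on_clique_sum: "continuous_on A (clique_sum R S)"
  unfolding clique_sum_def by (intro continuous_intros)

text \<open>A clique through \<open>v\<close> is \<open>v\<close> together with a clique among its
  neighbours, and the extra vertex contributes the factor \<open>- x\<close>.\<close>

lemma clique_sum_insert:
  assumes "symp R" "finite S" "v \<notin> S"
  shows "clique_sum R (insert v S) x = clique_sum R S x - x * clique_sum R {u \<in> S. R v u} x"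
proof -
  let ?A = "{K. K \<subseteq> S \<and> pairwise R K}"
  let ?B = "{K. K \<subseteq> {u \<in> S. R v u} \<and> pairwise R K}"
  have split: "{K. K \<subseteq> insert v S \<and> pairwise R K} = ?A \<union> insert v ` ?B" (is "?L = ?R")
  proof (intro set_eqI iffI)
    fix K assume K: "K \<in> ?L"
    show "K \<in> ?R"
    proof (cases "v \<in> K")
      case True
      have "K - {v} \<in> ?B"
        using K True by (auto simp: pairwise_def)
      moreover have "K = insert v (K - {v})"
        using True by blast
      ultimately show ?thesis
        by blast
    qed (use K in auto)
  next
    fix K assume "K \<in> ?R"
    moreover have "pairwise R (insert v K')" if "K' \<in> ?B" for K'
      using that sympD[OF assms(1)] by (fastforce simp: pairwise_insert)
    ultimately show "K \<in> ?L"
      by blast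
  qed
  have inj: "inj_on (insert v) ?B"
    using assms(3) by (auto simp: inj_on_def insert_ident subset_iff)
  have card: "card (insert v K) = Suc (card K)" if "K \<in> ?B" for K
    using that assms by (intro card_insert_disjoint) (auto dest: finite_subset)
  have "clique_sum R (insert v S) x =
      (\<Sum>K\<in>?A. (- x) ^ card K) + (\<Sum>K\<in>insert v ` ?B. (- x) ^ card K)"
    unfolding clique_sum_def split
    using assms by (intro sum.union_disjoint) auto
  also have "(\<Sum>K\<in>insert v ` ?B. (- x) ^ card K) = (\<Sum>K\<in>?B. - x * (- x) ^ card K)"
    using inj card by (simp add: sum.reindex)
  finally show ?thesis
    by (simp add: clique_sum_def sum_distrib_left sum_negf)
qed

lemma clique_sum_remove:
  assumes "symp R" "finite S" "v \<in> S"
  shows "clique_sum R S x = clique_sum R (S - {v}) x - x * clique_sum R {u \<in> S - {v}. R v u} x"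
  using clique_sum_insert[of R "S - {v}" v x] assms by (simp add: insert_absorb)

text \<open>Injectivity keeps clique sizes. This moves sums over the image of a section back to its
  domain.\<close>

lemma clique_sum_image:
  assumes "inj_on g S"
  shows "clique_sum R (g ` S) x = clique_sum (\<lambda>u v. R (g u) (g v)) S x"
proof -
  have "{K. K \<subseteq> g ` S \<and> pairwise R K} = (`) g ` {K. K \<subseteq> S \<and> pairwise (\<lambda>u v. R (g u) (g v)) K}"
    (is "?L = ?R")
  proof (intro set_eqI iffI)
    fix K assume "K \<in> ?L"
    then obtain K' where K': "K' \<subseteq> S" "K = g ` K'" "pairwise R K"
      by (auto simp: subset_image_iff)
    then have "pairwise (\<lambda>u v. R (g u) (g v)) K'"
      using assms unfolding pairwise_def inj_on_def by (metis imageI subsetD)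
    with K' show "K \<in> ?R"
      by blast
  next
    fix K assume "K \<in> ?R"
    then show "K \<in> ?L"
      by (auto simp: pairwise_def)
  qed
  moreover have "inj_on ((`) g) {K. K \<subseteq> S \<and> pairwise (\<lambda>u v. R (g u) (g v)) K}"
    using inj_on_image_Pow[OF assms] by (rule inj_on_subset) auto
  moreover have "card (g ` K) = card K" if "K \<subseteq> S" for K
    using inj_on_subset[OF assms that] by (rule card_image)
  ultimately show ?thesis
    by (simp add: clique_sum_def sum.reindex)
qed

section \<open>Positivity below the least root\<close>

text \<open>For \<open>S = B\<close> this is the intermediate value theorem from the value 1 at 0.
  Otherwise some \<open>v\<close> outside \<open>S\<close> is deleted; this creates no root up to
  \<open>x\<close>, since at a first such root the recurrence would make the sum over
  \<open>B\<close> nonpositive, forcing an earlier or equal root for \<open>B\<close>.\<close>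

lemma clique_sum_pos_if_no_root:
  assumes "symp R" "finite B" "0 \<le> x"
    and "\<And>y. 0 < y \<Longrightarrow> y \<le> x \<Longrightarrow> clique_sum R B y \<noteq> 0"
    and "S \<subseteq> B"
  shows "clique_sum R S x > 0"
  using assms(2-)
proof (induction B arbitrary: S x rule: finite_psubset_induct)
  case (psubset B)
  show ?case
  proof (cases "S = B")
    case True
    show ?thesis
    proof (rule ccontr)
      assume "\<not> ?thesis"
      then obtain y where y: "0 \<le> y" "y \<le> x" "clique_sum R B y = 0"
        using True IVT2'[of "clique_sum R B" x 0 0] psubset.prems(1)
          clique_sum_0[OF psubset.hyps(1), of R] continuous_on_clique_sum by auto
      moreover have "y \<noteq> 0"
        using y(3) clique_sum_0[OF psubset.hyps(1), of R] by auto
      ultimately show False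
        using psubset.prems(2)[of y] by simp
    qed
  next
    case False
    then obtain v where v: "v \<in> B" "v \<notin> S"
      using psubset.prems(3) by blast
    let ?B = "B - {v}" and ?N = "{u \<in> B - {v}. R v u}"
    have "?B \<subset> B" "finite ?B"
      using v psubset.hyps(1) by auto
    note IH = psubset.IH[OF \<open>?B \<subset> B\<close>]
    have "clique_sum R ?B y \<noteq> 0" if y: "0 < y" "y \<le> x" for y
    proof
      assume root: "clique_sum R ?B y = 0"
      let ?Z = "{z \<in> {0..x}. clique_sum R ?B z = 0}"
      have "compact ({0..x} \<inter> {z. clique_sum R ?B z = 0})"
        by (intro compact_Int_closed compact_Icc closed_Collect_eq continuous_on_clique_sum
            continuous_on_const)
      then have "compact ?Z"
        by (simp add: Int_def)
      moreover have "?Z \<noteq> {}"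
        using y root by auto
      ultimately obtain t where t: "t \<in> ?Z" and least: "\<And>z. z \<in> ?Z \<Longrightarrow> t \<le> z"
        using compact_attains_inf[of ?Z] by blast
      have "t > 0"
        using t clique_sum_0[OF \<open>finite ?B\<close>, of R] by (cases "t = 0") auto
      \<comment> \<open>Left of the first root \<open>t\<close> the induction hypothesis applies to
        \<open>B - {v}\<close> with \<open>z\<close> as the bound; continuity then gives only \<ge>
        0 at \<open>t\<close>, which suffices.\<close>
      have below: "clique_sum R ?N z > 0" if "z \<in> {0..<t}" for z
      proof (rule IH)
        fix z' assume "0 < z'" "z' \<le> z"
        then show "clique_sum R ?B z' \<noteq> 0"
          using least[of z'] t that by auto
      qed (use that in auto)
      have "clique_sum R ?N t \<ge> 0"
      proof (rule tendsto_lowerbound)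
        show "(clique_sum R ?N \<longlongrightarrow> clique_sum R ?N t) (at_left t)"
          using continuous_on_clique_sum[of UNIV R ?N]
          by (simp add: continuous_on_def filterlim_at_split)
        show "\<forall>\<^sub>F z in at_left t. 0 \<le> clique_sum R ?N z"
          using eventually_at_left_real[OF \<open>t > 0\<close>]
          by eventually_elim (use below in \<open>auto intro: less_imp_le\<close>)
      qed simp
      moreover have "clique_sum R B t = - t * clique_sum R ?N t"
        using clique_sum_remove[OF assms(1) psubset.hyps(1) v(1), of t] t by simp
      ultimately have "clique_sum R B t \<le> 0"
        using \<open>t > 0\<close> by simp
      then obtain z where z: "0 \<le> z" "z \<le> t" "clique_sum R B z = 0"
        using IVT2'[of "clique_sum R B" t 0 0] \<open>t > 0\<close>
          clique_sum_0[OF psubset.hyps(1), of R] continuous_on_clique_sum by auto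
      moreover have "z \<noteq> 0"
        using z(3) clique_sum_0[OF psubset.hyps(1), of R] by auto
      ultimately show False
        using psubset.prems(2)[of z] t by simp
    qed
    then show ?thesis
      using IH[of x S] psubset.prems v by blast
  qed
qed

section \<open>Comparing two relations on one vertex set\<close>

text \<open>By the recurrence, each added vertex subtracts \<open>x\<close> times a positive
  sum.\<close>

lemma clique_sum_antimono:
  assumes "symp R" "finite S" "0 \<le> x" "\<And>T. T \<subseteq> S \<Longrightarrow> clique_sum R T x > 0" "T \<subseteq> S"
  shows "clique_sum R S x \<le> clique_sum R T x"
  using assms(2,4,5)
proof (induction S rule: finite_psubset_induct)
  case (psubset S)
  show ?case
  proof (cases "T = S")
    case False
    then obtain v where v: "v \<in> S" "v \<notin> T"
      using psubset.prems(2) by blast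
    have "clique_sum R (S - {v}) x \<le> clique_sum R T x"
      using psubset.prems v by (intro psubset.IH) auto
    moreover have "0 < clique_sum R {u \<in> S - {v}. R v u} x"
      by (rule psubset.prems(1)) auto
    ultimately show ?thesis
      using clique_sum_remove[OF assms(1) psubset.hyps(1) v(1), of x] assms(3)
      by (smt (verit) mult_nonneg_nonneg)
  qed simp
qed

text \<open>The ratio comparison is cross-multiplied and proved together with positivity for
  \<open>Q\<close>: the one-vertex case needs positivity on smaller sets and yields it on
  \<open>S\<close>.\<close>

lemma clique_sum_ratio_mono:
  assumes "symp P" "symp Q" "finite S" "0 \<le> x"
    and PQ: "\<And>u v. u \<in> S \<Longrightarrow> v \<in> S \<Longrightarrow> u \<noteq> v \<Longrightarrow> P u v \<Longrightarrow> Q u v"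
    and pos: "\<And>T. T \<subseteq> S \<Longrightarrow> clique_sum P T x > 0"
  shows "clique_sum Q S x > 0 \<and> (\<forall>T \<subseteq> S.
    clique_sum P S x * clique_sum Q T x \<le> clique_sum Q S x * clique_sum P T x)"
  using assms(3) PQ pos
proof (induction S rule: finite_psubset_induct)
  case (psubset S)
  let ?p = "\<lambda>T. clique_sum P T x" and ?q = "\<lambda>T. clique_sum Q T x"
  have IH: "?q U > 0" "T \<subseteq> U \<Longrightarrow> ?p U * ?q T \<le> ?q U * ?p T" if "U \<subset> S" for T U
    using psubset.IH[OF that] psubset.prems that by (meson psubset_imp_subset subset_iff subset_trans)+
  have step: "?p S * ?q (S - {v}) \<le> ?q S * ?p (S - {v})" if "v \<in> S" for v
  proof -
    let ?NP = "{u \<in> S - {v}. P v u}" and ?NQ = "{u \<in> S - {v}. Q v u}"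
    have "?NP \<subseteq> ?NQ"
      using psubset.prems(1) that by auto
    \<comment> \<open>Here the added edges matter: they enlarge the neighbourhood of
      \<open>v\<close>, which lowers the \<open>P\<close>-sum over it.\<close>
    then have "?p ?NQ \<le> ?p ?NP"
      using psubset.hyps psubset.prems(2) assms(1,4) by (intro clique_sum_antimono) auto
    have "?p (S - {v}) * ?q ?NQ \<le> ?q (S - {v}) * ?p ?NQ"
      using that by (intro IH(2)) auto
    also have "\<dots> \<le> ?q (S - {v}) * ?p ?NP"
      using \<open>?p ?NQ \<le> ?p ?NP\<close> IH(1)[of "S - {v}"] that
      by (intro mult_left_mono) (auto intro: less_imp_le)
    finally have "x * (?p (S - {v}) * ?q ?NQ) \<le> x * (?q (S - {v}) * ?p ?NP)"
      using assms(4) by (rule mult_left_mono)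
    \<comment> \<open>Expanding both sums over \<open>S\<close> by the recurrence, the product of
      the two sums over \<open>S - {v}\<close> cancels and the inequality just obtained
      remains.\<close>
    then show ?thesis
      unfolding clique_sum_remove[OF assms(1) psubset.hyps(1) that, of x]
        clique_sum_remove[OF assms(2) psubset.hyps(1) that, of x]
      by (simp add: algebra_simps)
  qed
  have qpos: "?q S > 0"
  proof (cases "S = {}")
    case False
    then obtain v where v: "v \<in> S"
      by blast
    have "0 < ?p S * ?q (S - {v})"
      using v by (intro mult_pos_pos psubset.prems(2) IH(1)) auto
    also note step[OF v]
    finally show ?thesis
      using psubset.prems(2)[of "S - {v}"] by (simp add: zero_less_mult_iff)
  qed simp
  moreover have "?p S * ?q T \<le> ?q S * ?p T" if "T \<subseteq> S" for T
  proof (cases "T = S")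
    case False
    then obtain v where v: "v \<in> S" "v \<notin> T"
      using \<open>T \<subseteq> S\<close> by blast
    let ?U = "S - {v}"
    have U: "?p ?U > 0" "?p S > 0" "?p T > 0"
      using psubset.prems(2) \<open>T \<subseteq> S\<close> by auto
    \<comment> \<open>The ratios for \<open>S\<close> over \<open>?U\<close> and \<open>?U\<close>
      over \<open>T\<close> are multiplied; the positive factor \<open>?p ?U\<close> is cancelled at
      the end.\<close>
    have "?p ?U * (?p S * ?q T) = ?p S * (?p ?U * ?q T)"
      by simp
    also have "\<dots> \<le> ?p S * (?q ?U * ?p T)"
      using IH(2)[of ?U T] v that U by (intro mult_left_mono) auto
    also have "\<dots> \<le> (?q S * ?p ?U) * ?p T"
      using mult_right_mono[OF step[OF v(1)], of "?p T"] U by (simp add: mult.assoc)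
    also have "\<dots> = ?p ?U * (?q S * ?p T)"
      by simp
    finally show ?thesis
      using U by (simp only: mult_le_cancel_left_pos)
  qed simp
  ultimately show ?case
    by blast
qed

section \<open>Back to clique polynomials and homomorphisms\<close>

lemma is_clique_iff_pairwise:
  "is_clique G K \<longleftrightarrow> K \<subseteq> verts G \<and> pairwise (\<lambda>u v. u \<rightarrow>\<^bsub>G\<^esub> v) K"
  by (simp add: is_clique_def pairwise_def)

lemma is_clique_induce_subgraph:
  assumes "B \<subseteq> verts G"
  shows "is_clique (G \<restriction> B) K \<longleftrightarrow> is_clique G K \<and> K \<subseteq> B"
proof -
  have "u \<rightarrow>\<^bsub>G \<restriction> B\<^esub> v \<longleftrightarrow> u \<rightarrow>\<^bsub>G\<^esub> v" if "u \<in> B" "v \<in> B" for u v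
    using that by (auto simp: arcs_ends_def induce_subgraph_def arc_to_ends_def)
  then show ?thesis
    using assms by (auto simp: is_clique_def subset_iff)
qed

lemma poly_clique_poly:
  assumes "B \<subseteq> verts G" "finite B"
  shows "poly (clique_poly G B) x = clique_sum (\<lambda>u v. u \<rightarrow>\<^bsub>G\<^esub> v) B (- x)"
proof -
  let ?n = "clique_number (G \<restriction> B)" and ?C = "{K. K \<subseteq> B \<and> pairwise (\<lambda>u v. u \<rightarrow>\<^bsub>G\<^esub> v) K}"
  have C: "?C = {K. is_clique (G \<restriction> B) K}"
    using assms(1) by (auto simp: is_clique_induce_subgraph is_clique_iff_pairwise[of G])
  have "finite ?C"
    using assms(2) by simp
  \<comment> \<open>Truncating at the clique number of the induced subgraph loses no clique inside
    \<open>B\<close>.\<close>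
  then have bound: "card K \<in> {0..?n}" if "K \<in> ?C" for K
    using that unfolding C clique_number_def by auto
  have "clique_sum (\<lambda>u v. u \<rightarrow>\<^bsub>G\<^esub> v) B (- x) = (\<Sum>K\<in>?C. x ^ card K)"
    by (simp add: clique_sum_def)
  also have "\<dots> = (\<Sum>i = 0..?n. \<Sum>K | K \<in> ?C \<and> card K = i. x ^ card K)"
    using bound by (intro sum.group[symmetric] \<open>finite ?C\<close>) auto
  also have "\<dots> = (\<Sum>i = 0..?n. of_nat (clique_count G B i) * x ^ i)"
  proof (rule sum.cong)
    fix i
    have "{K. K \<subseteq> B \<and> card K = i \<and> is_clique G K} = {K. K \<in> ?C \<and> card K = i}"
      using assms(1) by (auto simp: is_clique_iff_pairwise)
    then show "(\<Sum>K | K \<in> ?C \<and> card K = i. x ^ card K) = of_nat (clique_count G B i) * x ^ i"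
      by (simp add: clique_count_def)
  qed simp
  also have "\<dots> = poly (clique_poly G B) x"
    by (simp add: clique_poly_def poly_sum poly_monom)
  finally show ?thesis ..
qed

theorem corollary4p4:
  fixes G :: "('a, 'b) pre_digraph" and H :: "('c, 'd) pre_digraph"
    and B_G :: "'a set" and B_H :: "'c set"
  assumes "graph G" and "graph H"
    and "B_G \<subseteq> verts G" and "B_H \<subseteq> verts H"
    and "zeta G B_G < zeta H B_H"
  shows "\<not> (\<exists>f. surj_graph_hom G H f \<and> f ` B_G = B_H)"
proof
  assume "\<exists>f. surj_graph_hom G H f \<and> f ` B_G = B_H"
  then obtain f where f: "surj_graph_hom G H f" "f ` B_G = B_H"
    by blast
  interpret G: graph G by fact
  interpret H: graph H by fact
  let ?RG = "\<lambda>u v. u \<rightarrow>\<^bsub>G\<^esub> v" and ?RH = "\<lambda>u v. u \<rightarrow>\<^bsub>H\<^esub> v"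
  have fin: "finite B_G" "finite B_H"
    using assms(3,4) by (auto dest: finite_subset)
  have sym: "symp ?RG" "symp ?RH"
    using G.sym_arcs H.sym_arcs by (auto intro!: sympI dest: arcs_ends_symmetric)
  have finH: "finite (neg_roots H B_H)" and finG: "finite (neg_roots G B_G)"
    using fin by (auto intro: finite_neg_roots)
  \<comment> \<open>The strict inequality rules out the value -\<infinity> for
    \<open>zeta H B_H\<close>.\<close>
  have ne: "neg_roots H B_H \<noteq> {}"
    using assms(5) by (auto simp: zeta_def)
  \<comment> \<open>\<open>t\<close> is the least positive root of the alternating sum for
    \<open>B_H\<close>, because of the sign change in the variable.\<close>
  define t where "t = - Max (neg_roots H B_H)"
  have "- t \<in> neg_roots H B_H"
    using Max_in[OF finH ne] by (simp add: t_def)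
  then have t: "t > 0" "clique_sum ?RH B_H t = 0"
    using poly_clique_poly[OF assms(4) fin(2), of "- t"] by (auto simp: neg_roots_def)
  have noroot: "clique_sum ?RG B_G y \<noteq> 0" if "0 < y" "y \<le> t" for y
  proof
    assume "clique_sum ?RG B_G y = 0"
    then have root: "- y \<in> neg_roots G B_G"
      using that poly_clique_poly[OF assms(3) fin(1), of "- y"] by (simp add: neg_roots_def)
    then have "zeta G B_G \<ge> ereal (- y)"
      using Max_ge[OF finG root] by (auto simp: zeta_def)
    moreover have "zeta H B_H = ereal (- t)"
      using ne by (simp add: zeta_def t_def)
    ultimately show False
      using assms(5) that by (metis ereal_less_eq(3) leD le_less_trans neg_le_iff_le)
  qed
  define g where "g = inv_into B_G f"
  have g: "g u \<in> B_G" "f (g u) = u" if "u \<in> B_H" for u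
    using that f(2) by (auto simp: g_def inv_into_into f_inv_into_f)
  have inj: "inj_on g B_H"
    using g(2) by (metis inj_onI)
  \<comment> \<open>On \<open>B_H\<close>, \<open>?P\<close> is contained in adjacency of
    \<open>H\<close>, because \<open>f\<close> is a homomorphism and \<open>g\<close> a section of
    it.\<close>
  let ?P = "\<lambda>u v. g u \<rightarrow>\<^bsub>G\<^esub> g v"
  have "clique_sum ?RH B_H t > 0"
  proof (rule clique_sum_ratio_mono[THEN conjunct1])
    show "symp ?P"
      using sym(1) by (auto simp: symp_def)
    show "u \<rightarrow>\<^bsub>H\<^esub> v" if "u \<in> B_H" "v \<in> B_H" "g u \<rightarrow>\<^bsub>G\<^esub> g v" for u v
      using f(1) that g(2) by (metis graph_hom_def surj_graph_hom_def)
    fix S assume S: "S \<subseteq> B_H"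
    \<comment> \<open>The image of the section lies in \<open>B_G\<close>, whose alternating sum has
      no root in (0, t].\<close>
    have "clique_sum ?RG (g ` S) t > 0"
      using S g(1) t(1) noroot sym fin by (intro clique_sum_pos_if_no_root[of _ B_G]) auto
    then show "clique_sum ?P S t > 0"
      using clique_sum_image[OF inj_on_subset[OF inj S], of ?RG t] by simp
  qed (use sym fin t in auto)
  with t(2) show False
    by simp
qed

end
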